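(* The elementary local $L$-factor associated with the vector space $V=\mathbb C^{\ell+1}$, $$L_V^{(0)}(s)=\prod_{j=1}^{\ell+1}\frac{1}{s-\lambda_j},$$ is expressed through the $U_1^{\ell+1}$-equivariant symplectic volume $Z$ of $V$ as follows: $$L_V^{(0)}(s)=Z(\lambda_1-s,\dots,\lambda_{\ell+1}-s).$$
   Context: $\imath=\sqrt{-1}$, $s\in\mathbb C$, and $\Lambda=\mathrm{diag}(\lambda_1,\dots,\lambda_{\ell+1})$ is a diagonal endomorphism of $V=\mathbb C^{\ell+1}$, which carries the standard action of $U_{\ell+1}$. With complex linear coordinates $z^1,\dots,z^{\ell+1}$, $V$ has the symplectic form $\omega=\frac{\imath}{2}\sum_{j=1}^{\ell+1}dz^j\wedge d\bar z^j$. The action of the diagonal subgroup $U_1^{\ell+1}\subset U_{\ell+1}$ is Hamiltonian, with momenta $H_j=\frac{\imath}{2}|z^j|^2$, $j=1,\dots,\ell+1$. The $U_1^{\ell+1}$-equivariant volume of $V$ is defined as the integral $$Z(\lambda_1,\dots,\lambda_{\ell+1})=\frac{1}{(2\pi)^{\ell+1}}\int_{\mathbb C^{\ell+1}}e^{\omega+\sum_{j=1}^{\ell+1}H_j\lambda_j}=\frac{1}{(2\pi)^{\ell+1}}\int_{\mathbb C^{\ell+1}}\frac{\omega^{\ell+1}}{(\ell+1)!}\,e^{\sum_{j=1}^{\ell+1}H_j\lambda_j}.$$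
   Formalization: With momenta H_j=(i/2)|z^j|^2 the identity fails by i^(l+1); it is proved for H_j=|z^j|^2/2 where the integral converges (Re s > Re λ_j), elsewhere by analytic continuation, and for the printed H_j as L(s)=i^(l+1) Z(λ-s) when Im s < Im λ_j. *)

theory Defs
  imports "HOL-Analysis.Analysis"
begin

text \<open>
  Alternating forms on a vector space. A form of degree \<open>k\<close> is a function of a
  sequence of vectors that only looks at the entries \<open>0, \<dots>, k - 1\<close>; the degrees are
  passed to the wedge product explicitly. The normalisation is the one in which
  \<open>(\<alpha> \<and> \<beta>) (u, v) = \<alpha> u * \<beta> v - \<alpha> v * \<beta> u\<close> for \<open>1\<close>-forms.
\<close>

type_synonym 'v form = "(nat \<Rightarrow> 'v) \<Rightarrow> complex"

definition wedge :: "nat \<Rightarrow> nat \<Rightarrow> 'v form \<Rightarrow> 'v form \<Rightarrow> 'v form" where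
  "wedge k l \<alpha> \<beta> = (\<lambda>v. (\<Sum>\<sigma> | \<sigma> permutes {..<k + l}.
      of_int (sign \<sigma>) * \<alpha> (\<lambda>i. v (\<sigma> i)) * \<beta> (\<lambda>i. v (\<sigma> (k + i)))) / (fact k * fact l))"

primrec wedge_power :: "nat \<Rightarrow> 'v form \<Rightarrow> nat \<Rightarrow> 'v form" where
  "wedge_power k \<alpha> 0 = (\<lambda>v. 1)"
| "wedge_power k \<alpha> (Suc m) = wedge k (m * k) \<alpha> (wedge_power k \<alpha> m)"

definition dz :: "'n::finite \<Rightarrow> (complex ^ 'n) form" where
  "dz j = (\<lambda>v. v 0 $ j)"

definition dzbar :: "'n::finite \<Rightarrow> (complex ^ 'n) form" where
  "dzbar j = (\<lambda>v. cnj (v 0 $ j))"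

definition symplectic_form :: "(complex ^ 'n::finite) form" where
  "symplectic_form = (\<lambda>v. \<i> / 2 * (\<Sum>j\<in>UNIV. wedge 1 1 (dz j) (dzbar j) v))"

text \<open>
  The real frame \<open>e\<^sub>1, \<i> e\<^sub>1, e\<^sub>2, \<i> e\<^sub>2, \<dots>\<close>, positively oriented for the complex orientation.
  Reordering the coordinates permutes pairs of vectors, so the choice of enumeration of the
  index type does not affect the value of a form of top degree on it.
\<close>

definition complex_frame :: "nat \<Rightarrow> complex ^ 'n::finite" where
  "complex_frame i = axis (from_nat_into UNIV (i div 2)) (if even i then 1 else \<i>)"

text \<open>
  Integration over the whole space of a differential form of top degree \<open>2 * CARD('n)\<close>,
  given as a form \<open>\<eta> z\<close> at each point \<open>z\<close>. The frame above is orthonormal, so evaluating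
  on it gives the density with respect to Lebesgue measure.
\<close>

definition form_integrable :: "(complex ^ 'n::finite \<Rightarrow> (complex ^ 'n) form) \<Rightarrow> bool" where
  "form_integrable \<eta> \<longleftrightarrow> integrable lborel (\<lambda>z. \<eta> z complex_frame)"

definition form_integral :: "(complex ^ 'n::finite \<Rightarrow> (complex ^ 'n) form) \<Rightarrow> complex" where
  "form_integral \<eta> = (LINT z|lborel. \<eta> z complex_frame)"

text \<open>
  The top-degree part of \<open>exp (\<omega> + (\<Sum>j. H\<^sub>j * \<mu>\<^sub>j))\<close> and the equivariant volume, for given
  momenta \<open>H\<^sub>j\<close>.
\<close>

definition volume_integrand ::
  "('n::finite \<Rightarrow> complex ^ 'n \<Rightarrow> complex) \<Rightarrow> complex ^ 'n \<Rightarrow> complex ^ 'n \<Rightarrow> (complex ^ 'n) form" where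
  "volume_integrand H \<mu> z = (\<lambda>v. wedge_power 2 symplectic_form CARD('n) v / fact CARD('n)
      * exp (\<Sum>j\<in>UNIV. H j z * \<mu> $ j))"

definition equivariant_volume ::
  "('n::finite \<Rightarrow> complex ^ 'n \<Rightarrow> complex) \<Rightarrow> complex ^ 'n \<Rightarrow> complex" where
  "equivariant_volume H \<mu> =
     1 / (2 * complex_of_real pi) ^ CARD('n) * form_integral (volume_integrand H \<mu>)"

text \<open>
  Two normalisations of the momenta of the diagonal torus action. The first is the real
  Hamiltonian of the rotation \<open>z\<^sub>j \<mapsto> exp (\<i> * t) * z\<^sub>j\<close> (see \<open>momentum_hamiltonian\<close>); the
  second differs by a factor \<open>\<i>\<close>, i.e. refers to the generator of the rotation multiplied
  by \<open>\<i>\<close>. A factor \<open>c\<close> in the momenta multiplies the equivariant volume by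
  \<open>1 / c ^ CARD('n)\<close> and rotates its domain of convergence, so the two give different volumes.
\<close>

definition momentum :: "'n::finite \<Rightarrow> complex ^ 'n \<Rightarrow> complex" where
  "momentum j z = 1 / 2 * of_real ((cmod (z $ j))\<^sup>2)"

definition imaginary_momentum :: "'n::finite \<Rightarrow> complex ^ 'n \<Rightarrow> complex" where
  "imaginary_momentum j z = \<i> / 2 * of_real ((cmod (z $ j))\<^sup>2)"

definition L_factor :: "complex ^ 'n::finite \<Rightarrow> complex \<Rightarrow> complex" where
  "L_factor lam s = (\<Prod>j\<in>UNIV. 1 / (s - lam $ j))"

lemma symplectic_form_eq:
  "symplectic_form v = \<i> / 2 * (\<Sum>j\<in>UNIV. v 0 $ j * cnj (v 1 $ j) - v 1 $ j * cnj (v 0 $ j))"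
proof -
  have eq: "{..<Suc (Suc 0)} = insert 0 {Suc 0}" by auto
  have "wedge 1 1 (dz j) (dzbar j) v = v 0 $ j * cnj (v 1 $ j) - v 1 $ j * cnj (v 0 $ j)" for j
    by (simp add: wedge_def dz_def dzbar_def eq sum_over_permutations_insert
        permutes_sing sign_swap_id)
  then show ?thesis by (simp add: symplectic_form_def)
qed

lemma momentum_hamiltonian:
  fixes z :: "complex ^ 'n::finite"
  shows "(momentum j has_derivative
           (\<lambda>w. symplectic_form (\<lambda>i. if i = 0 then w else axis j (\<i> * z $ j)))) (at z)"
proof -
  have m: "momentum j = (\<lambda>z. 1 / 2 * (z $ j * cnj (z $ j)))"
    by (rule ext) (simp only: momentum_def complex_norm_square)
  have s: "symplectic_form (\<lambda>i. if i = 0 then w else axis j (\<i> * z $ j)) =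
      1 / 2 * (z $ j * cnj (w $ j) + w $ j * cnj (z $ j))" for w
  proof -
    have "(\<Sum>k\<in>UNIV. w $ k * cnj (axis j (\<i> * z $ j) $ k) - axis j (\<i> * z $ j) $ k * cnj (w $ k))
        = (\<Sum>k\<in>UNIV. if k = j then w $ j * cnj (\<i> * z $ j) - \<i> * z $ j * cnj (w $ j) else 0)"
      by (rule sum.cong) (auto simp: axis_def)
    also have "\<dots> = w $ j * cnj (\<i> * z $ j) - \<i> * z $ j * cnj (w $ j)"
      by simp
    finally have "symplectic_form (\<lambda>i. if i = 0 then w else axis j (\<i> * z $ j)) =
        \<i> / 2 * (w $ j * cnj (\<i> * z $ j) - \<i> * z $ j * cnj (w $ j))"
      by (simp add: symplectic_form_eq)
    then show ?thesis
      by (simp add: algebra_simps)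
  qed
  have "((\<lambda>z. 1 / 2 * (z $ j * cnj (z $ j))) has_derivative
      (\<lambda>w. 1 / 2 * (z $ j * cnj (w $ j) + w $ j * cnj (z $ j)))) (at z)"
    by (intro has_derivative_mult_right has_derivative_mult has_derivative_cnj
        bounded_linear.has_derivative[OF bounded_linear_vec_nth] has_derivative_ident)
  then show ?thesis by (simp only: m s)
qed

end

theory Submission
  imports Defs "HOL-Probability.Distributions" "HOL-Complex_Analysis.Conformal_Mappings"
begin

text \<open>
  At the heart of the statement is one Gaussian integral. Evaluated on the real frame
  \<open>e\<^sub>1, \<i> e\<^sub>1, e\<^sub>2, \<i> e\<^sub>2, \<dots>\<close>, the top exterior power of the symplectic form divided by \<open>n!\<close>
  is \<open>1\<close> (\<open>wedge_power_symplectic_frame\<close>), so up to the power of \<open>2 * pi\<close> the equivariant volume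
  is the Lebesgue integral of \<open>exp (\<Sum>j. a * \<mu>\<^sub>j * (cmod z\<^sub>j)\<^sup>2)\<close>, where \<open>a\<close> is \<open>1 / 2\<close> or
  \<open>\<i> / 2\<close> depending on the normalisation of the momenta. It splits over the complex coordinates,
  and for \<open>Re c < 0\<close> the integral of \<open>exp (c * (cmod z)\<^sup>2)\<close> over the plane is \<open>- pi / c\<close>.
  Dividing by \<open>2 * pi\<close> in each coordinate leaves the factor \<open>- 1 / (2 * a * \<mu>\<^sub>j)\<close>
  (\<open>quadratic_momentum_volume\<close>). For \<open>\<mu>\<^sub>j = \<lambda>\<^sub>j - s\<close> and \<open>a = 1 / 2\<close> this is
  \<open>1 / (s - \<lambda>\<^sub>j)\<close>, convergent to the right of all \<open>\<lambda>\<^sub>j\<close>; for \<open>a = \<i> / 2\<close> it is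
  \<open>1 / (\<i> * (s - \<lambda>\<^sub>j))\<close>, convergent below all \<open>\<lambda>\<^sub>j\<close>.

  The evaluation on the frame amounts to the fact that the Pfaffian of a block diagonal matrix is
  the product over its blocks (\<open>wedge_power_block_orthogonal\<close>). It follows by induction on the
  number of blocks, splitting off the values of a permutation at the first two positions
  (\<open>wedge_2_expand\<close>).

  In the planar integral the coefficient \<open>c\<close> is complex. The squared modulus pushes area forward to
  \<open>pi\<close> times length on the half line (\<open>distr_cmod_squared\<close>), and there \<open>exp (c * t)\<close> has the
  primitive \<open>exp (c * t) / c\<close> for complex \<open>c\<close> as well.

  Outside the half plane of convergence the volume enters only through analytic continuation, which
  is unique because the complement of the finitely many poles is connected
  (\<open>L_factor_unique_continuation\<close>).
\<close>

section \<open>Powers of a 2-form\<close>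

text \<open>Short for the transposition of two indices, as opposed to the transpose of a matrix.\<close>

abbreviation swap :: "nat \<Rightarrow> nat \<Rightarrow> nat \<Rightarrow> nat" where
  "swap \<equiv> Transposition.transpose"

text \<open>
  The wedge product is a signed sum over all permutations, so precomposing with \<open>\<pi>\<close> only
  relabels the summands and costs a sign.
\<close>

lemma wedge_permute:
  assumes \<pi>: "\<pi> permutes {..<k + l}"
  shows "wedge k l \<alpha> \<beta> (\<lambda>i. v (\<pi> i)) = of_int (sign \<pi>) * wedge k l \<alpha> \<beta> v"
proof -
  let ?t = "\<lambda>\<sigma>. of_int (sign \<sigma>) * \<alpha> (\<lambda>i. v (\<sigma> i)) * \<beta> (\<lambda>i. v (\<sigma> (k + i)))"
  have perm: "permutation \<pi>" "permutation \<sigma>" if "\<sigma> permutes {..<k + l}" for \<sigma>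
    using \<pi> that by (auto intro: permutes_imp_permutation[rotated])
  have "(\<Sum>\<sigma> | \<sigma> permutes {..<k + l}. ?t \<sigma>) = (\<Sum>\<sigma> | \<sigma> permutes {..<k + l}. ?t (\<pi> \<circ> \<sigma>))"
    by (rule setum_permutations_compose_left[OF \<pi>])
  also have "\<dots> = of_int (sign \<pi>) * (\<Sum>\<sigma> | \<sigma> permutes {..<k + l}. of_int (sign \<sigma>) *
      \<alpha> (\<lambda>i. v (\<pi> (\<sigma> i))) * \<beta> (\<lambda>i. v (\<pi> (\<sigma> (k + i)))))"
    unfolding sum_distrib_left
    by (rule sum.cong) (auto simp: sign_compose perm)
  finally have "(\<Sum>\<sigma> | \<sigma> permutes {..<k + l}. of_int (sign \<sigma>) *
      \<alpha> (\<lambda>i. v (\<pi> (\<sigma> i))) * \<beta> (\<lambda>i. v (\<pi> (\<sigma> (k + i))))) =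
      of_int (sign \<pi>) * (\<Sum>\<sigma> | \<sigma> permutes {..<k + l}. ?t \<sigma>)"
    by (simp add: mult.assoc[symmetric] flip: of_int_mult)
  then show ?thesis by (simp add: wedge_def)
qed

lemma wedge_power_permute:
  assumes "\<pi> permutes {..<m * k}"
  shows "wedge_power k \<alpha> m (\<lambda>i. v (\<pi> i)) = of_int (sign \<pi>) * wedge_power k \<alpha> m v"
  using assms by (cases m) (simp_all add: wedge_permute)

text \<open>
  Each permutation of \<open>{..<l + 2}\<close> is uniquely \<open>swap 0 b \<circ> swap 1 c \<circ> q\<close> with \<open>q\<close> fixing \<open>0\<close>
  and \<open>1\<close>. The factor \<open>q\<close> only shuffles the arguments of \<open>\<beta>\<close>, where its sign cancels by
  alternation. Hence all \<open>fact l\<close> choices of \<open>q\<close> contribute equally, which removes the factor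
  \<open>fact l\<close> from the normalisation.
\<close>

lemma wedge_2_expand:
  assumes \<alpha>: "\<And>v. \<alpha> v = B (v 0) (v 1)"
    and \<beta>: "\<And>\<pi> v. \<pi> permutes {..<l} \<Longrightarrow> \<beta> (\<lambda>i. v (\<pi> i)) = of_int (sign \<pi>) * \<beta> v"
  shows "wedge 2 l \<alpha> \<beta> f =
    (\<Sum>b<l + 2. \<Sum>c=1..<l + 2. let \<theta> = swap 0 b \<circ> swap 1 c in
       of_int (sign \<theta>) * B (f (\<theta> 0)) (f (\<theta> 1)) * \<beta> (\<lambda>i. f (\<theta> (2 + i)))) / 2"
proof -
  let ?S = "{2..<l + 2}"
  let ?t = "\<lambda>\<sigma>. of_int (sign \<sigma>) * \<alpha> (\<lambda>i. f (\<sigma> i)) * \<beta> (\<lambda>i. f (\<sigma> (2 + i)))"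
  let ?u = "\<lambda>\<theta>. of_int (sign \<theta>) * B (f (\<theta> 0)) (f (\<theta> 1)) * \<beta> (\<lambda>i. f (\<theta> (2 + i)))"
  have S: "{..<2 + l} = insert 0 (insert 1 ?S)" "insert 1 ?S = {1..<l + 2}"
    "insert 0 (insert 1 ?S) = {..<l + 2}" by auto
  have inner: "?t (\<theta> \<circ> q) = ?u \<theta>" if q: "q permutes ?S" and \<theta>: "permutation \<theta>" for \<theta> q
  proof -
    \<comment> \<open>the permutation \<open>q\<close> seen on the argument positions of \<open>\<beta>\<close>\<close>
    define q' where "q' = map_permutation ?S (\<lambda>i. i - 2) q"
    have inj: "inj_on (\<lambda>i. i - 2) ?S" by (auto simp: inj_on_def)
    have bij: "bij_betw (\<lambda>i. i - 2) ?S {..<l}"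
      by (rule bij_betwI[where g = "\<lambda>i. i + 2"]) auto
    have q': "q' permutes {..<l}"
      unfolding q'_def by (rule map_permutation_permutes[OF bij q])
    have sign: "sign q' = sign q"
      unfolding q'_def by (rule sign_map_permutation) (use q inj in auto)
    have shift: "q (2 + i) = 2 + q' i" for i
    proof (cases "i < l")
      case True
      have "q' (i + 2 - 2) = q (i + 2) - 2"
        unfolding q'_def by (rule map_permutation_apply[OF inj]) (use True in auto)
      moreover have "q (i + 2) \<in> ?S" using True by (subst permutes_in_image[OF q]) auto
      ultimately show ?thesis by (auto simp: add.commute)
    next
      case False
      then show ?thesis using permutes_not_in[OF q, of "2 + i"] permutes_not_in[OF q', of i] by auto
    qed
    have "q 0 = 0" "q 1 = 1" using permutes_not_in[OF q] by auto
    moreover have "sign (\<theta> \<circ> q) = sign \<theta> * sign q"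
      using \<theta> by (rule sign_compose) (rule permutes_imp_permutation[OF _ q], simp)
    ultimately show ?thesis
      using \<beta>[OF q', of "\<lambda>i. f (\<theta> (2 + i))"]
      by (simp add: \<alpha> shift[simplified] sign mult.assoc[symmetric] flip: of_int_mult)
  qed
  have const: "(\<Sum>q | q permutes ?S. z) = fact l * z" for z :: complex
    by (simp add: card_permutations)
  have cancel: "fact l * z / (fact 2 * fact l) = z / 2" for z :: complex
    by simp
  have outer: "(\<Sum>\<sigma> | \<sigma> permutes insert 0 (insert 1 ?S). ?t \<sigma>) = (\<Sum>b\<in>insert 0 (insert 1 ?S).
      \<Sum>q | q permutes insert 1 ?S. ?t (swap 0 b \<circ> q))"
    by (rule sum_over_permutations_insert) auto
  have step: "(\<Sum>q | q permutes insert 1 ?S. ?t (swap 0 b \<circ> q)) =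
      (\<Sum>c\<in>insert 1 ?S. \<Sum>q | q permutes ?S. ?t (swap 0 b \<circ> (swap 1 c \<circ> q)))" for b
    by (rule sum_over_permutations_insert) auto
  have "(\<Sum>\<sigma> | \<sigma> permutes {..<2 + l}. ?t \<sigma>) =
      (\<Sum>b<l + 2. \<Sum>c=1..<l + 2. \<Sum>q | q permutes ?S. ?t ((swap 0 b \<circ> swap 1 c) \<circ> q))"
    unfolding S(1) outer step unfolding S(3) unfolding S(2) o_assoc ..
  also have "\<dots> = (\<Sum>b<l + 2. \<Sum>c=1..<l + 2. \<Sum>q | q permutes ?S. ?u (swap 0 b \<circ> swap 1 c))"
    by (intro sum.cong refl inner permutation_compose permutation_swap_id) auto
  also have "\<dots> = fact l * (\<Sum>b<l + 2. \<Sum>c=1..<l + 2. ?u (swap 0 b \<circ> swap 1 c))"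
    by (simp only: const sum_distrib_left)
  finally show ?thesis
    unfolding wedge_def Let_def by (simp only: cancel)
qed

text \<open>
  Moving the block \<open>k\<close> to the front exchanges the factors \<open>d 0\<close> and \<open>d k\<close>; if the move also
  reverses the order inside both blocks, both factors change sign, and the signs cancel.
\<close>

lemma prod_exchange_first:
  fixes d :: "nat \<Rightarrow> complex"
  assumes k: "0 < k" "k < n" and s: "s * s = 1"
    and e: "e 0 = s * d k" "e k = s * d 0" "\<And>i. i \<noteq> 0 \<Longrightarrow> i \<noteq> k \<Longrightarrow> e i = d i"
  shows "prod e {..<n} = prod d {..<n}"
proof -
  have split: "prod h {..<n} = h 0 * (h k * prod h ({..<n} - {0} - {k}))" for h :: "nat \<Rightarrow> complex"
    using k prod.remove[of "{..<n}" 0 h] prod.remove[of "{..<n} - {0}" k h] by simp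
  have "prod e ({..<n} - {0} - {k}) = prod d ({..<n} - {0} - {k})"
    by (rule prod.cong) (auto intro: e)
  then show ?thesis using s by (simp add: split e mult_ac)
qed

text \<open>
  If the vectors \<open>f 0, f 1, f 2, \<dots>\<close> come in pairs \<open>f (2 * i), f (2 * i + 1)\<close> that are mutually
  \<open>B\<close>-orthogonal, then a term \<open>(b, c)\<close> of the expansion above survives only if the first two
  positions receive a pair, so each of the \<open>2 * m + 2\<close> values of \<open>b\<close> leaves exactly one \<open>c\<close>.
  The corresponding permutation carries pairs to pairs, so the remaining vectors are again of the
  same kind and induction applies. All surviving terms are equal; together with the factor
  \<open>1 / 2\<close> this multiplies the value by \<open>m + 1\<close> in each step.
\<close>

lemma wedge_power_block_orthogonal:
  assumes \<alpha>: "\<And>v. \<alpha> v = B (v 0) (v 1)"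
    and anti: "\<And>x y. B y x = - B x y"
    and orth: "\<And>i j. i < 2 * m \<Longrightarrow> j < 2 * m \<Longrightarrow> i div 2 \<noteq> j div 2 \<Longrightarrow> B (f i) (f j) = 0"
  shows "wedge_power 2 \<alpha> m f = fact m * (\<Prod>i<m. B (f (2 * i)) (f (2 * i + 1)))"
  using orth
proof (induction m arbitrary: f)
  case 0
  then show ?case by simp
next
  case (Suc m)
  let ?W = "wedge_power 2 \<alpha> m"
  let ?\<theta> = "\<lambda>b c. swap 0 b \<circ> swap 1 c :: nat \<Rightarrow> nat"
  let ?u = "\<lambda>\<theta>. of_int (sign \<theta>) * B (f (\<theta> 0)) (f (\<theta> 1)) * ?W (\<lambda>i. f (\<theta> (2 + i)))"
  let ?P = "\<Prod>i<Suc m. B (f (2 * i)) (f (2 * i + 1))"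
  have inner: "(\<Sum>c=1..<m * 2 + 2. ?u (?\<theta> b c)) = fact m * ?P" if b: "b < m * 2 + 2" for b
  proof -
    \<comment> \<open>\<open>p\<close> is the index paired with \<open>b\<close>, and \<open>c0\<close> the choice of \<open>c\<close> that puts it at position \<open>1\<close>\<close>
    define p where "p = (if even b then b + 1 else b - 1)"
    define c0 where "c0 = swap 0 b p"
    have p: "p \<noteq> b" "p < m * 2 + 2" "p div 2 = b div 2"
      and p_unique: "\<And>j. j div 2 = b div 2 \<Longrightarrow> j \<noteq> b \<Longrightarrow> j = p"
      unfolding p_def using b by presburger+
    have c0: "c0 \<in> {1..<m * 2 + 2}"
      using p b by (auto simp: c0_def Transposition.transpose_def)
    have zero: "?u (?\<theta> b c) = 0" if c: "c \<in> {1..<m * 2 + 2}" "c \<noteq> c0" for c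
    proof -
      have "swap 0 b c \<noteq> b" "swap 0 b c \<noteq> p" "swap 0 b c < m * 2 + 2"
        using c b p by (auto simp: c0_def Transposition.transpose_def split: if_splits)
      then have "B (f b) (f (swap 0 b c)) = 0"
        using b p_unique by (intro Suc.prems) fastforce+
      then show ?thesis using c by (simp add: Transposition.transpose_def[of 1 c])
    qed
    have main: "?u (?\<theta> b c0) = fact m * ?P"
    proof -
      define \<theta> where "\<theta> = ?\<theta> b c0"
      define k where "k = b div 2"
      let ?e = "\<lambda>i. B (f (\<theta> (2 * i))) (f (\<theta> (2 * i + 1)))"
      have k: "k < Suc m" using b by (auto simp: k_def)
      have block_iff: "i div 2 = j \<longleftrightarrow> i = 2 * j \<or> i = 2 * j + 1" for i j :: nat
        by presburger
      have "b = 0 \<or> b = 1 \<or> (b = 2 * k \<and> 0 < k) \<or> (b = 2 * k + 1 \<and> 0 < k)"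
        unfolding k_def by presburger
      then consider "b = 0" | "b = 1" | "b = 2 * k" "0 < k" | "b = 2 * k + 1" "0 < k"
        by blast
      \<comment> \<open>\<open>\<theta>\<close> exchanges the blocks \<open>0\<close> and \<open>k\<close>. For odd \<open>b\<close> it also reverses the order inside
        them; only for \<open>b = 1\<close>, where they coincide, is that a single sign change, and then \<open>\<theta>\<close> is odd.\<close>
      then have "of_int (sign \<theta>) * prod ?e {..<Suc m} = ?P \<and>
          (\<forall>i. \<theta> i div 2 = swap 0 k (i div 2))"
      proof cases
        case 1
        then have "\<theta> = id" "k = 0"
          by (simp_all add: \<theta>_def c0_def p_def k_def)
        then show ?thesis by simp
      next
        case 2
        have "c0 = 1" by (simp add: c0_def p_def 2)
        then have \<theta>: "\<theta> = swap 0 1" and "k = 0"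
          by (simp_all add: \<theta>_def 2 k_def)
        have "prod ?e {..<Suc m} = - ?P"
          unfolding prod.lessThan_Suc_shift
          by (simp add: \<theta> Transposition.transpose_def anti[of "f 0" "f (Suc 0)"])
        moreover have "\<theta> i div 2 = i div 2" for i
          by (auto simp: \<theta> Transposition.transpose_def)
        ultimately show ?thesis using \<open>k = 0\<close> by (simp add: \<theta> sign_swap_id)
      next
        case 3
        have "c0 = 2 * k + 1" using 3 by (simp add: c0_def p_def)
        then have \<theta>: "\<theta> = swap 0 (2 * k) \<circ> swap 1 (2 * k + 1)"
          using 3 by (simp add: \<theta>_def)
        have \<theta>_block: "\<theta> 0 = 2 * k" "\<theta> 1 = 2 * k + 1" "\<theta> (2 * k) = 0" "\<theta> (2 * k + 1) = 1"
          using 3 by (simp_all add: \<theta> Transposition.transpose_def)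
        have \<theta>_other: "\<theta> i = i" if "i div 2 \<noteq> 0" "i div 2 \<noteq> k" for i
          using that by (auto simp: \<theta> Transposition.transpose_def)
        have "prod ?e {..<Suc m} = ?P"
        proof (rule prod_exchange_first[where k = k and s = "1"])
          show "?e i = B (f (2 * i)) (f (2 * i + 1))" if "i \<noteq> 0" "i \<noteq> k" for i
            using that by (simp add: \<theta>_other)
        qed (use 3 k \<theta>_block in simp_all)
        moreover have "sign \<theta> = 1"
          using 3 by (simp add: \<theta> sign_compose permutation_swap_id sign_swap_id)
        moreover have "\<theta> i div 2 = swap 0 k (i div 2)" for i
        proof (cases "i div 2 = 0 \<or> i div 2 = k")
          case True
          then have "i = 0 \<or> i = 1 \<or> i = 2 * k \<or> i = 2 * k + 1" by (auto simp: block_iff)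
          then show ?thesis using \<theta>_block by auto
        next
          case False
          then show ?thesis by (simp add: \<theta>_other)
        qed
        ultimately show ?thesis by simp
      next
        case 4
        have "c0 = 2 * k" using 4 by (simp add: c0_def p_def)
        then have \<theta>: "\<theta> = swap 0 (2 * k + 1) \<circ> swap 1 (2 * k)"
          using 4 by (simp add: \<theta>_def)
        have \<theta>_block: "\<theta> 0 = 2 * k + 1" "\<theta> 1 = 2 * k" "\<theta> (2 * k) = 1" "\<theta> (2 * k + 1) = 0"
          using 4 by (simp_all add: \<theta> Transposition.transpose_def)
        have \<theta>_other: "\<theta> i = i" if "i div 2 \<noteq> 0" "i div 2 \<noteq> k" for i
          using that by (auto simp: \<theta> Transposition.transpose_def)
        have "prod ?e {..<Suc m} = ?P"
        proof (rule prod_exchange_first[where k = k and s = "- 1"])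
          show "?e i = B (f (2 * i)) (f (2 * i + 1))" if "i \<noteq> 0" "i \<noteq> k" for i
            using that by (simp add: \<theta>_other)
        qed (use 4 k \<theta>_block anti[of "f 0" "f 1"]
            anti[of "f (2 * k)" "f (2 * k + 1)"] in simp_all)
        moreover have "sign \<theta> = 1"
          using 4 by (simp add: \<theta> sign_compose permutation_swap_id sign_swap_id)
        moreover have "\<theta> i div 2 = swap 0 k (i div 2)" for i
        proof (cases "i div 2 = 0 \<or> i div 2 = k")
          case True
          then have "i = 0 \<or> i = 1 \<or> i = 2 * k \<or> i = 2 * k + 1" by (auto simp: block_iff)
          then show ?thesis using \<theta>_block by auto
        next
          case False
          then show ?thesis by (simp add: \<theta>_other)
        qed
        ultimately show ?thesis by simp
      qed
      then have sgn: "of_int (sign \<theta>) * prod ?e {..<Suc m} = ?P"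
        and block: "\<And>i. \<theta> i div 2 = swap 0 k (i div 2)" by auto
      have bound: "\<theta> i < 2 * Suc m" if "i < 2 * Suc m" for i
        using that b c0 by (auto simp: \<theta>_def Transposition.transpose_def)
      have "?W (\<lambda>i. f (\<theta> (2 + i))) =
          fact m * (\<Prod>i<m. B (f (\<theta> (2 + 2 * i))) (f (\<theta> (2 + (2 * i + 1)))))"
      proof (rule Suc.IH, rule Suc.prems)
        fix i j :: nat assume ij: "i < 2 * m" "j < 2 * m" "i div 2 \<noteq> j div 2"
        show "\<theta> (2 + i) < 2 * Suc m" "\<theta> (2 + j) < 2 * Suc m"
          "\<theta> (2 + i) div 2 \<noteq> \<theta> (2 + j) div 2"
          by (use bound[of "2 + i"] bound[of "2 + j"] ij in \<open>simp_all add: block transpose_eq_iff\<close>)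
      qed
      then have "?u \<theta> = fact m * (of_int (sign \<theta>) * prod ?e {..<Suc m})"
        unfolding prod.lessThan_Suc_shift by (simp add: mult_ac)
      then show ?thesis unfolding sgn unfolding \<theta>_def .
    qed
    have "(\<Sum>c=1..<m * 2 + 2. ?u (?\<theta> b c)) = ?u (?\<theta> b c0)"
    proof -
      have "(\<Sum>c\<in>{1..<m * 2 + 2} - {c0}. ?u (?\<theta> b c)) = 0"
        by (rule sum.neutral) (blast intro: zero)
      then show ?thesis using c0 by (simp only: sum.remove finite_atLeastLessThan add_0_right)
    qed
    with main show ?thesis by simp
  qed
  have "wedge_power 2 \<alpha> (Suc m) f =
      (\<Sum>b<m * 2 + 2. \<Sum>c=1..<m * 2 + 2. ?u (?\<theta> b c)) / 2"
    unfolding wedge_power.simps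
    by (rule wedge_2_expand[OF \<alpha> wedge_power_permute, unfolded Let_def])
  also have "\<dots> = (\<Sum>b<m * 2 + 2. fact m * ?P) / 2"
    by (intro arg_cong[where f = "\<lambda>x. x / 2"] sum.cong refl inner) simp
  also have "\<dots> = fact (Suc m) * ?P"
    unfolding sum_constant card_lessThan by (simp add: field_simps del: prod.lessThan_Suc)
  finally show ?case .
qed

text \<open>
  In the real frame \<open>e\<^sub>1, \<i> e\<^sub>1, e\<^sub>2, \<i> e\<^sub>2, \<dots>\<close> the symplectic form is block diagonal with every
  block equal to \<open>1\<close>: the Liouville volume is Lebesgue measure.
\<close>

lemma wedge_power_symplectic_frame:
  "wedge_power 2 symplectic_form CARD('n) (complex_frame :: nat \<Rightarrow> complex ^ 'n::finite)
    = fact CARD('n)"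
proof -
  define B where "B = (\<lambda>x y :: complex ^ 'n. \<i> / 2 * (\<Sum>j\<in>UNIV. x $ j * cnj (y $ j) - y $ j * cnj (x $ j)))"
  let ?f = "complex_frame :: nat \<Rightarrow> complex ^ 'n"
  have inj: "inj_on (from_nat_into (UNIV :: 'n set)) {..<CARD('n)}"
    using bij_betw_from_nat_into_finite[of "UNIV :: 'n set"] by (auto simp: bij_betw_def)
  have anti: "B y x = - B x y" for x y
    by (simp add: B_def algebra_simps sum_subtractf)
  have ax: "B (axis a x) (axis b y) = (if a = b then \<i> / 2 * (x * cnj y - y * cnj x) else 0)" for a b x y
  proof -
    have "(\<Sum>j\<in>UNIV. axis a x $ j * cnj (axis b y $ j) - axis b y $ j * cnj (axis a x $ j)) =
       (\<Sum>j\<in>UNIV. if j = a then (if a = b then x * cnj y - y * cnj x else 0) else 0)"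
      by (rule sum.cong) (auto simp: axis_def)
    then show ?thesis by (simp add: B_def)
  qed
  have "wedge_power 2 symplectic_form CARD('n) ?f =
      fact CARD('n) * (\<Prod>i<CARD('n). B (?f (2 * i)) (?f (2 * i + 1)))"
  proof (rule wedge_power_block_orthogonal)
    show "symplectic_form v = B (v 0) (v 1)" for v :: "nat \<Rightarrow> complex ^ 'n"
      by (simp add: symplectic_form_eq B_def)
  next
    fix i j :: nat assume "i < 2 * CARD('n)" "j < 2 * CARD('n)" "i div 2 \<noteq> j div 2"
    moreover from this have "i div 2 < CARD('n)" "j div 2 < CARD('n)" by linarith+
    ultimately show "B (?f i) (?f j) = 0"
      using inj_onD[OF inj, of "i div 2" "j div 2"] by (auto simp: complex_frame_def ax)
  qed (rule anti)
  also have "(\<Prod>i<CARD('n). B (?f (2 * i)) (?f (2 * i + 1))) = 1"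
    by (simp add: complex_frame_def ax)
  finally show ?thesis by simp
qed

section \<open>Gaussian integrals with complex coefficients\<close>

text \<open>The modulus of the integrand is, up to a constant, a normal density.\<close>

lemma integrable_complex_gaussian_real:
  assumes "Re c < 0"
  shows "integrable lborel (\<lambda>x :: real. exp (c * of_real (x\<^sup>2)))"
proof -
  define \<sigma> where "\<sigma> = sqrt (1 / (- 2 * Re c))"
  have \<sigma>: "\<sigma> > 0" "\<sigma>\<^sup>2 = 1 / (- 2 * Re c)" using assms by (auto simp: \<sigma>_def divide_less_0_iff)
  have "integrable lborel (\<lambda>x. sqrt (2 * pi * \<sigma>\<^sup>2) * normal_density 0 \<sigma> x)"
    using \<sigma>(1) by (intro integrable_mult_right integrable_normal_density)
  also have "(\<lambda>x. sqrt (2 * pi * \<sigma>\<^sup>2) * normal_density 0 \<sigma> x) = (\<lambda>x. exp (Re c * x\<^sup>2))"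
    using \<sigma>(1) assms unfolding normal_density_def
    by (auto simp: fun_eq_iff \<sigma>(2) real_sqrt_mult real_sqrt_divide field_simps)
  finally show ?thesis
    by (rule Bochner_Integration.integrable_bound) (auto simp: norm_exp_eq_Re)
qed

text \<open>
  A disc of squared radius \<open>t\<close> has area \<open>pi * t\<close>, so \<open>(cmod z)\<^sup>2\<close> is uniformly distributed on the
  half line. This replaces polar coordinates: it turns a radial integral over the plane into a
  one-dimensional one without any change of variables.
\<close>

lemma distr_cmod_squared:
  "distr lborel borel (\<lambda>z :: complex. (cmod z)\<^sup>2) = density lborel (\<lambda>t. pi * indicator {0..} t)"
    (is "?M = ?N")
proof (rule measure_eqI_generator_eq[where \<Omega> = UNIV and E = "range atMost" and A = "\<lambda>n. {..real n}"])
  have M: "emeasure ?M {..a} = ennreal (pi * max 0 a)" for a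
  proof -
    have "emeasure ?M {..a} = emeasure lborel ((\<lambda>z :: complex. (cmod z)\<^sup>2) -` {..a})"
      by (subst emeasure_distr) auto
    also have "(\<lambda>z :: complex. (cmod z)\<^sup>2) -` {..a} = (if a < 0 then {} else cball 0 (sqrt a))"
      by (auto simp: real_le_rsqrt sqrt_le_D not_le dest: order_trans[OF zero_le_power2])
         (metis norm_ge_zero real_sqrt_le_iff real_sqrt_abs abs_of_nonneg)+
    finally show ?thesis
      by (auto simp: emeasure_cball unit_ball_vol_2 max_def)
  qed
  have N: "emeasure ?N {..a} = ennreal (pi * max 0 a)" for a
  proof -
    have "emeasure ?N {..a} = (\<integral>\<^sup>+ x. ennreal pi * indicator {0..a} x \<partial>lborel)"
      by (subst emeasure_density) (auto intro!: nn_integral_cong simp: indicator_def)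
    also have "\<dots> = ennreal (pi * max 0 a)"
      by (subst nn_integral_cmult_indicator) (auto simp: ennreal_mult' max_def)
    finally show ?thesis .
  qed
  show "emeasure ?M X = emeasure ?N X" if "X \<in> range atMost" for X
    using that M N by auto
  show "emeasure ?M {..real n} \<noteq> \<infinity>" for n by (simp add: M)
  show "Int_stable (range (atMost :: real \<Rightarrow> _))"
    by (auto simp: Int_stable_def)
  show "sets ?M = sigma_sets UNIV (range atMost)" "sets ?N = sigma_sets UNIV (range atMost)"
    by (simp_all add: borel_eq_atMost)
  show "(\<Union>n. {..real n}) = UNIV" by (auto simp: real_arch_simple)
qed auto

lemma integral_exp_half_line:
  assumes c: "Re c < 0"
  shows "set_integrable lborel {0<..} (\<lambda>t :: real. exp (c * of_real t))"
    and "(LBINT t:{0<..}. exp (c * of_real t)) = - 1 / c"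
proof -
  have "integrable lborel (\<lambda>x. exponential_density (- Re c) x / - Re c)"
  proof (intro integrable_divide_zero impI)
    interpret prob_space "density lborel (exponential_density (- Re c))"
      using c by (intro prob_space_exponential_density) simp
    have "integrable (density lborel (exponential_density (- Re c))) (\<lambda>_. 1 :: real)" by simp
    then show "integrable lborel (exponential_density (- Re c))"
      using c by (subst (asm) integrable_density) (auto intro!: exponential_density_nonneg)
  qed
  then show int: "set_integrable lborel {0<..} (\<lambda>t :: real. exp (c * of_real t))"
    unfolding set_integrable_def
    by (rule Bochner_Integration.integrable_bound)
       (use c in \<open>auto simp: exponential_density_def norm_exp_eq_Re indicator_def abs_mult abs_of_neg mult.commute\<close>)
  have c0: "c \<noteq> 0" using c by auto
  have "(LBINT t=0..\<infinity>. exp (c * of_real t)) = 0 - 1 / c"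
  proof (rule interval_integral_FTC_integrable[where F = "\<lambda>t. exp (c * of_real t) / c"])
    show "((\<lambda>t. exp (c * of_real t) / c) has_vector_derivative exp (c * of_real x)) (at x)" for x :: real
      using c0 by (auto intro!: derivative_eq_intros has_vector_derivative_real_field)
    show "set_integrable lborel (einterval 0 \<infinity>) (\<lambda>t :: real. exp (c * of_real t))"
      using int by (simp add: einterval_def zero_ereal_def greaterThan_def)
    show "(((\<lambda>t. exp (c * of_real t) / c) \<circ> real_of_ereal) \<longlongrightarrow> 1 / c) (at_right 0)"
      unfolding zero_ereal_def ereal_tendsto_simps1
      using c0 by (auto intro!: tendsto_eq_intros)
    have "((\<lambda>t. exp (Re c * t)) \<longlongrightarrow> 0) at_top"
      using c by (intro filterlim_compose[OF exp_at_bot] filterlim_tendsto_neg_mult_at_bot[OF tendsto_const]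
          filterlim_ident)
    then have "((\<lambda>t :: real. exp (c * of_real t)) \<longlongrightarrow> 0) at_top"
      by (subst tendsto_norm_zero_iff[symmetric]) (simp add: norm_exp_eq_Re)
    then show "(((\<lambda>t. exp (c * of_real t) / c) \<circ> real_of_ereal) \<longlongrightarrow> 0) (at_left \<infinity>)"
      unfolding ereal_tendsto_simps1 by (rule tendsto_divide_zero)
  qed (auto intro!: continuous_intros)
  then show "(LBINT t:{0<..}. exp (c * of_real t)) = - 1 / c"
    by (simp add: interval_lebesgue_integral_0_infty)
qed

lemma integral_complex_gaussian_plane:
  assumes c: "Re c < 0"
  shows "(LINT z|lborel. exp (c * of_real ((cmod z)\<^sup>2))) = - of_real pi / c"
proof -
  let ?g = "\<lambda>t :: real. exp (c * of_real t)"
  have "(LINT z|lborel. ?g ((cmod z)\<^sup>2)) = (LINT t|distr lborel borel (\<lambda>z :: complex. (cmod z)\<^sup>2). ?g t)"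
    by (subst integral_distr) auto
  also have "\<dots> = (LINT t|lborel. (pi * indicator {0..} t) *\<^sub>R ?g t)"
    unfolding distr_cmod_squared by (subst integral_density) auto
  also have "\<dots> = (LINT t|lborel. of_real pi * (indicator {0<..} t *\<^sub>R ?g t))"
    by (rule integral_cong_AE, measurable, rule AE_I'[of "{0}"])
      (auto simp: indicator_def scaleR_conv_of_real)
  also have "\<dots> = of_real pi * (LBINT t:{0<..}. ?g t)"
    by (simp add: set_lebesgue_integral_def del: mult_scaleR_right)
  also have "\<dots> = - of_real pi / c"
    by (simp add: integral_exp_half_line[OF c])
  finally show ?thesis .
qed

text \<open>
  Fubini for a diagonal Gaussian, whose integrand is a product over the orthonormal basis. It is
  used both for the plane and for \<open>complex ^ 'n\<close>.
\<close>

lemma integral_gaussian_euclidean: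
  fixes c :: "'a::euclidean_space \<Rightarrow> complex"
  assumes c: "\<And>b. b \<in> Basis \<Longrightarrow> Re (c b) < 0"
  shows "integrable lborel (\<lambda>z. exp (\<Sum>b\<in>Basis. c b * of_real ((z \<bullet> b)\<^sup>2)))"
    and "(LINT z|lborel. exp (\<Sum>b\<in>Basis. c b * of_real ((z \<bullet> b)\<^sup>2))) =
         (\<Prod>b\<in>Basis. LINT x|lborel. exp (c b * of_real (x\<^sup>2)))"
proof -
  let ?g = "\<lambda>b (x :: real). exp (c b * of_real (x\<^sup>2))"
  let ?E = "\<lambda>x :: 'a \<Rightarrow> real. \<Sum>b\<in>Basis. x b *\<^sub>R b"
  let ?P = "\<Pi>\<^sub>M b\<in>(Basis :: 'a set). (lborel :: real measure)"
  interpret product_sigma_finite "\<lambda>_ :: 'a. lborel :: real measure" ..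
  have eq: "exp (\<Sum>b\<in>Basis. c b * of_real ((z \<bullet> b)\<^sup>2)) = (\<Prod>b\<in>Basis. ?g b (z \<bullet> b))" for z :: 'a
    by (simp add: exp_sum)
  have E: "?E \<in> measurable ?P borel" by measurable
  have comp: "(\<Prod>b\<in>Basis. ?g b (?E x \<bullet> b)) = (\<Prod>b\<in>Basis. ?g b (x b))" for x
    by (rule prod.cong) (auto simp: inner_sum_left_Basis)
  have meas: "(\<lambda>z :: 'a. \<Prod>b\<in>Basis. ?g b (z \<bullet> b)) \<in> borel_measurable borel" by measurable
  show "integrable lborel (\<lambda>z :: 'a. exp (\<Sum>b\<in>Basis. c b * of_real ((z \<bullet> b)\<^sup>2)))"
    unfolding eq
    apply (subst lborel_eq)
    apply (subst integrable_distr_eq[OF E meas])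
    unfolding comp
    by (rule product_integrable_prod) (use c integrable_complex_gaussian_real in auto)
  show "(LINT z|lborel. exp (\<Sum>b\<in>Basis. c b * of_real ((z \<bullet> b)\<^sup>2))) = (\<Prod>b\<in>Basis. LINT x|lborel. ?g b x)"
    unfolding eq
    apply (subst lborel_eq)
    apply (subst integral_distr[OF E meas])
    unfolding comp
    by (rule product_integral_prod) (use c integrable_complex_gaussian_real in auto)
qed

text \<open>
  Only the square of the one-dimensional integral is ever needed, since each complex coordinate
  consists of two real ones. The square is the planar integral read backwards through Fubini, which
  avoids choosing a branch of the square root of \<open>- pi / c\<close>.
\<close>

lemma integral_complex_gaussian_real_squared:
  assumes c: "Re c < 0"
  shows "(LINT x|lborel. exp (c * of_real (x\<^sup>2)))\<^sup>2 = - of_real pi / c"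
proof -
  have "(LINT z|lborel. exp (\<Sum>b\<in>(Basis :: complex set). c * of_real ((z \<bullet> b)\<^sup>2))) =
      (\<Prod>b\<in>(Basis :: complex set). LINT x|lborel. exp (c * of_real (x\<^sup>2)))"
    by (rule integral_gaussian_euclidean(2)) (use c in auto)
  also have "\<dots> = (LINT x|lborel. exp (c * of_real (x\<^sup>2)))\<^sup>2"
    by (simp add: Basis_complex_def power2_eq_square)
  also have "(\<lambda>z. exp (\<Sum>b\<in>(Basis :: complex set). c * of_real ((z \<bullet> b)\<^sup>2))) =
      (\<lambda>z. exp (c * of_real ((cmod z)\<^sup>2)))"
    by (simp add: fun_eq_iff Basis_complex_def cmod_power2 inner_complex_def distrib_left)
  finally show ?thesis using integral_complex_gaussian_plane[OF c] by simp
qed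

lemma complex_vec_Basis: "(Basis :: (complex ^ 'n::finite) set) = (\<Union>j. {axis j 1, axis j \<i>})"
  by (auto simp: Basis_vec_def Basis_complex_def)

lemma sum_prod_Basis_complex_vec:
  fixes h :: "complex ^ 'n::finite \<Rightarrow> complex"
  shows "(\<Sum>b\<in>Basis. h b) = (\<Sum>j\<in>UNIV. h (axis j 1) + h (axis j \<i>))"
   and "(\<Prod>b\<in>Basis. h b) = (\<Prod>j\<in>UNIV. h (axis j 1) * h (axis j \<i>))"
  unfolding complex_vec_Basis
  by (subst sum.UNION_disjoint prod.UNION_disjoint; auto simp: axis_eq_axis)+

lemma integral_complex_gaussian:
  fixes c :: "complex ^ 'n::finite"
  assumes c: "\<And>j. Re (c $ j) < 0"
  shows "integrable lborel (\<lambda>z :: complex ^ 'n. exp (\<Sum>j\<in>UNIV. c $ j * of_real ((cmod (z $ j))\<^sup>2)))"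
    and "(LINT z|lborel. exp (\<Sum>j\<in>UNIV. c $ j * of_real ((cmod (z $ j))\<^sup>2))) =
         (\<Prod>j\<in>UNIV. - of_real pi / c $ j)"
proof -
  \<comment> \<open>the complex coordinate in which the real basis vector \<open>b\<close> lives\<close>
  define ix :: "complex ^ 'n \<Rightarrow> 'n" where "ix b = (THE j. b $ j \<noteq> 0)" for b
  have ix: "ix (axis j x) = j" if "x \<noteq> 0" for j x
    unfolding ix_def using that by (auto simp: axis_def split: if_splits)
  have sum: "(\<Sum>b\<in>Basis. c $ ix b * of_real ((z \<bullet> b)\<^sup>2)) =
      (\<Sum>j\<in>UNIV. c $ j * of_real ((cmod (z $ j))\<^sup>2))" for z
    by (simp add: sum_prod_Basis_complex_vec ix inner_axis inner_complex_def cmod_power2 distrib_left)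
  show "integrable lborel (\<lambda>z :: complex ^ 'n. exp (\<Sum>j\<in>UNIV. c $ j * of_real ((cmod (z $ j))\<^sup>2)))"
    using integral_gaussian_euclidean(1)[of "\<lambda>b. c $ ix b"] c by (simp only: sum)
  have "(LINT z|lborel. exp (\<Sum>j\<in>UNIV. c $ j * of_real ((cmod (z $ j))\<^sup>2))) =
      (\<Prod>b\<in>(Basis :: (complex ^ 'n) set). LINT x|lborel. exp (c $ ix b * of_real (x\<^sup>2)))"
    using integral_gaussian_euclidean(2)[of "\<lambda>b. c $ ix b"] c by (simp only: sum)
  also have "\<dots> = (\<Prod>j\<in>UNIV. (LINT x|lborel. exp (c $ j * of_real (x\<^sup>2)))\<^sup>2)"
    by (simp add: sum_prod_Basis_complex_vec ix power2_eq_square)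
  also have "\<dots> = (\<Prod>j\<in>UNIV. - of_real pi / c $ j)"
    using c by (simp only: integral_complex_gaussian_real_squared)
  finally show "(LINT z|lborel. exp (\<Sum>j\<in>UNIV. c $ j * of_real ((cmod (z $ j))\<^sup>2))) =
         (\<Prod>j\<in>UNIV. - of_real pi / c $ j)" .
qed

section \<open>The equivariant volume and the local factor\<close>

text \<open>
  Both normalisations of the momenta are \<open>a * (cmod (z $ j))\<^sup>2\<close>, with \<open>a = 1 / 2\<close> and
  \<open>a = \<i> / 2\<close>; the convergence condition and the value depend on \<open>a\<close> only through \<open>a * \<mu> $ j\<close>.
\<close>

lemma quadratic_momentum_volume:
  fixes \<mu> :: "complex ^ 'n::finite"
  assumes H: "\<And>j z. H j z = a * of_real ((cmod (z $ j))\<^sup>2)"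
    and conv: "\<And>j. Re (a * \<mu> $ j) < 0"
  shows "form_integrable (volume_integrand H \<mu>)"
    and "equivariant_volume H \<mu> = (\<Prod>j\<in>UNIV. - 1 / (2 * a * \<mu> $ j))"
proof -
  let ?c = "\<chi> j. a * \<mu> $ j"
  have density: "volume_integrand H \<mu> z complex_frame =
      exp (\<Sum>j\<in>UNIV. ?c $ j * of_real ((cmod (z $ j))\<^sup>2))" for z
    by (simp add: volume_integrand_def wedge_power_symplectic_frame H mult_ac)
  show "form_integrable (volume_integrand H \<mu>)"
    unfolding form_integrable_def density
    by (rule integral_complex_gaussian(1)) (simp add: conv del: times_complex.sel)
  have "form_integral (volume_integrand H \<mu>) = (\<Prod>j\<in>UNIV. - of_real pi / ?c $ j)"
    unfolding form_integral_def density
    by (rule integral_complex_gaussian(2)) (simp add: conv del: times_complex.sel)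
  then have "equivariant_volume H \<mu> =
      (\<Prod>j\<in>(UNIV :: 'n set). 1 / (2 * complex_of_real pi)) * (\<Prod>j\<in>UNIV. - of_real pi / ?c $ j)"
    by (simp add: equivariant_volume_def power_divide)
  also have "\<dots> = (\<Prod>j\<in>UNIV. - 1 / (2 * a * \<mu> $ j))"
    unfolding prod.distrib[symmetric] by (intro prod.cong) (auto simp: field_simps)
  finally show "equivariant_volume H \<mu> = (\<Prod>j\<in>UNIV. - 1 / (2 * a * \<mu> $ j))" .
qed

text \<open>
  The half plane to the right of all \<open>lam $ j\<close> is open and nonempty, and removing finitely many
  points leaves the plane connected, so a holomorphic function on the complement of the poles is
  determined by its values on that half plane.
\<close>

lemma L_factor_unique_continuation:
  fixes lam :: "complex ^ 'n::finite"
  shows "F holomorphic_on (- range (($) lam)) \<and> (\<forall>s. (\<forall>j. Re (lam $ j) < Re s) \<longrightarrow> F s = L_factor lam s)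
     \<longleftrightarrow> (\<forall>s \<in> - range (($) lam). F s = L_factor lam s)" (is "?L \<longleftrightarrow> ?R")
proof -
  let ?D = "- range (($) lam)" and ?U = "{s. \<forall>j. Re (lam $ j) < Re s}"
  have hol: "L_factor lam holomorphic_on ?D"
    unfolding L_factor_def[abs_def] by (auto intro!: holomorphic_intros)
  have U: "?U \<subseteq> ?D" by auto
  show ?thesis
  proof
    assume R: ?R
    then have "F holomorphic_on ?D" using holomorphic_transform[OF hol] by metis
    with R U show ?L by blast
  next
    assume L: ?L
    have "?U = (\<Inter>j\<in>UNIV. {s. Re (lam $ j) < Re s})" by auto
    then have U_open: "open ?U" by (auto intro!: open_INT open_halfspace_Re_gt)
    have D_open: "open ?D" by (auto intro!: finite_imp_closed)
    have D_connected: "connected ?D"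
      unfolding Compl_eq_Diff_UNIV by (rule connected_open_delete_finite) auto
    have "complex_of_real (Max (range (\<lambda>j. Re (lam $ j))) + 1) \<in> ?U"
    proof -
      have "Re (lam $ j) \<le> Max (range (\<lambda>j. Re (lam $ j)))" for j
        by (rule Max_ge) auto
      then have "Re (lam $ j) < Max (range (\<lambda>j. Re (lam $ j))) + 1" for j
        by (rule le_less_trans) simp
      then show ?thesis by simp
    qed
    then have "?U \<noteq> {}" by blast
    note continuation = analytic_continuation_open[OF U_open D_open this D_connected U _ hol]
    have "F s = L_factor lam s" if "s \<in> ?U" for s
      using L that by blast
    then show ?R
      using continuation[of F] L by blast
  qed
qed

theorem lemma5p1:
  fixes lam :: "complex ^ 'n::finite"
  shows "(\<forall>s. (\<forall>j. Re (lam $ j) < Re s) \<longrightarrow>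
            form_integrable (volume_integrand momentum (\<chi> j. lam $ j - s)) \<and>
            L_factor lam s = equivariant_volume momentum (\<chi> j. lam $ j - s))
       \<and> (\<forall>F. F holomorphic_on (- range (($) lam)) \<and>
              (\<forall>s. (\<forall>j. Re (lam $ j) < Re s) \<longrightarrow>
                 F s = equivariant_volume momentum (\<chi> j. lam $ j - s))
            \<longleftrightarrow> (\<forall>s \<in> - range (($) lam). F s = L_factor lam s))
       \<and> (\<forall>s. (\<forall>j. Im s < Im (lam $ j)) \<longrightarrow>
            form_integrable (volume_integrand imaginary_momentum (\<chi> j. lam $ j - s)) \<and>
            L_factor lam s =
              \<i> ^ CARD('n) * equivariant_volume imaginary_momentum (\<chi> j. lam $ j - s))"
proof -
  have real: "form_integrable (volume_integrand momentum (\<chi> j. lam $ j - s))"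
    "L_factor lam s = equivariant_volume momentum (\<chi> j. lam $ j - s)"
    if s: "\<forall>j. Re (lam $ j) < Re s" for s
  proof -
    have conv: "Re (1 / 2 * (\<chi> j. lam $ j - s) $ j) < 0" for j
      using s by simp
    note volume = quadratic_momentum_volume[where H = momentum, OF momentum_def conv]
    show "form_integrable (volume_integrand momentum (\<chi> j. lam $ j - s))"
      by (rule volume(1))
    show "L_factor lam s = equivariant_volume momentum (\<chi> j. lam $ j - s)"
      unfolding volume(2) L_factor_def
      by (rule prod.cong) (auto simp: minus_divide_right simp del: divide_minus_right)
  qed
  have imaginary: "form_integrable (volume_integrand imaginary_momentum (\<chi> j. lam $ j - s))"
    "L_factor lam s = \<i> ^ CARD('n) * equivariant_volume imaginary_momentum (\<chi> j. lam $ j - s)"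
    if s: "\<forall>j. Im s < Im (lam $ j)" for s
  proof -
    have conv: "Re (\<i> / 2 * (\<chi> j. lam $ j - s) $ j) < 0" for j
      using s by simp
    note volume = quadratic_momentum_volume[where H = imaginary_momentum,
        OF imaginary_momentum_def conv]
    show "form_integrable (volume_integrand imaginary_momentum (\<chi> j. lam $ j - s))"
      by (rule volume(1))
    \<comment> \<open>each coordinate contributes \<open>1 / \<i>\<close>, which one factor of \<open>\<i> ^ CARD('n)\<close> compensates\<close>
    have "\<i> * (- 1 / (2 * (\<i> / 2) * (lam $ j - s))) = 1 / (s - lam $ j)" for j
    proof -
      have "lam $ j - s \<noteq> 0" "s - lam $ j \<noteq> 0" using s by (auto dest: spec[of _ j])
      then show ?thesis by (simp add: field_simps)
    qed
    then have "L_factor lam s =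
        (\<Prod>j\<in>(UNIV :: 'n set). \<i>) * (\<Prod>j\<in>UNIV. - 1 / (2 * (\<i> / 2) * (lam $ j - s)))"
      unfolding prod.distrib[symmetric] L_factor_def by simp
    then show "L_factor lam s =
        \<i> ^ CARD('n) * equivariant_volume imaginary_momentum (\<chi> j. lam $ j - s)"
      unfolding volume(2) by simp
  qed
  have "(\<forall>s. (\<forall>j. Re (lam $ j) < Re s) \<longrightarrow>
          F s = equivariant_volume momentum (\<chi> j. lam $ j - s)) \<longleftrightarrow>
        (\<forall>s. (\<forall>j. Re (lam $ j) < Re s) \<longrightarrow> F s = L_factor lam s)" for F
    by (simp add: real(2))
  note continuation = L_factor_unique_continuation[of _ lam, folded this]
  show ?thesis
    using real imaginary continuation by (intro conjI allI impI) assumption+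
qed

end
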